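(* Let $N\ge1$ be an integer and let $\Lambda\subset\mathbb{C}\cong\mathbb{R}^2$ be the lattice generated by $1$ and $\theta=\sqrt{-N}$ (a lattice with rectangular Voronoi cell). For $\alpha=a+b\sqrt{-N}$ with $a,b\in\mathbb{Z}$, $\alpha\neq0$, the sublattice $\alpha\Lambda$ is clean if and only if $\alpha\bar\alpha=a^2+Nb^2$ is odd (equivalently, $a+Nb$ is odd).
   Context: A sublattice $\Lambda'\subseteq\Lambda$ is clean if the boundaries of the Voronoi cells of $\Lambda'$ (in $\mathbb{R}^2$) contain no point of $\Lambda$. *)

theory Defs
  imports "HOL-Analysis.Analysis"
begin

definition generated_lattice :: "complex \<Rightarrow> complex \<Rightarrow> complex set" where
  "generated_lattice u v = {of_int m * u + of_int n * v | m n. True}"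

(* "independent" refers to complex as a real vector space, so these are the full-rank lattices
   in the plane. *)
definition is_lattice :: "complex set \<Rightarrow> bool" where
  "is_lattice L \<longleftrightarrow> (\<exists>u v. u \<noteq> v \<and> independent {u, v} \<and> L = generated_lattice u v)"

definition sublattice :: "complex set \<Rightarrow> complex set \<Rightarrow> bool" where
  "sublattice L' L \<longleftrightarrow> is_lattice L' \<and> is_lattice L \<and> L' \<subseteq> L"

definition voronoi_cell :: "complex set \<Rightarrow> complex \<Rightarrow> complex set" where
  "voronoi_cell L p = {z. \<forall>q\<in>L. dist z p \<le> dist z q}"

definition clean_sublattice :: "complex set \<Rightarrow> complex set \<Rightarrow> bool" where
  "clean_sublattice L' L \<longleftrightarrow>
     sublattice L' L \<and> (\<forall>p\<in>L'. frontier (voronoi_cell L' p) \<inter> L = {})"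

end

theory Submission
  imports Defs
begin

text \<open>
  The Voronoi cell of \<open>\<alpha> p\<close> in \<open>\<alpha> \<Lambda>\<close> is \<open>\<alpha> (p + R)\<close>, where \<open>R\<close> is the rectangle with half-sides
  \<open>1/2\<close> and \<open>\<surd>N/2\<close>. If \<open>\<lambda> = \<alpha> (p + x)\<close> with \<open>\<lambda>\<close> in \<open>\<Lambda>\<close> and \<open>x\<close> on the boundary of \<open>R\<close>, then
  multiplying by \<open>cnj \<alpha>\<close> and comparing real or imaginary parts gives an identity
  \<open>2 u = \<alpha> cnj \<alpha> (2 k \<plusminus> 1)\<close> in integers, so \<open>\<alpha> cnj \<alpha>\<close> is even. Conversely, if
  \<open>a\<^sup>2 + N b\<^sup>2\<close> is even, then one of \<open>\<alpha>/2\<close>, \<open>\<alpha> \<theta>/2\<close>, \<open>\<alpha> (1 + \<theta>)/2\<close> lies in \<open>\<Lambda>\<close>, and it is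
  a boundary point of the cell of \<open>0\<close>.
\<close>

text \<open>\<open>Im (cnj u * v)\<close> is the determinant of \<open>u\<close> and
  \<open>v\<close> as plane vectors: if \<open>u\<close> were a real multiple of \<open>v\<close>,
  then \<open>cnj u * v\<close> would be real.\<close>

lemma independent_complex_pair:
  assumes "Im (cnj u * v) \<noteq> 0"
  shows "u \<noteq> v" and "independent {u, v}"
proof -
  show ne: "u \<noteq> v"
    using assms by auto
  have "u \<noteq> 0" "v \<noteq> 0"
    using assms by auto
  moreover have "u \<notin> span {v}"
    using assms by (auto simp: span_singleton)
  ultimately show "independent {u, v}"
    using ne by (simp add: independent_insert)
qed

lemma is_lattice_generated:
  assumes "Im (cnj u * v) \<noteq> 0"
  shows "is_lattice (generated_lattice u v)"
  unfolding is_lattice_def using independent_complex_pair[OF assms] by blast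

lemma generated_latticeI: "of_int m * u + of_int n * v \<in> generated_lattice u v"
  by (auto simp: generated_lattice_def)

lemma generated_latticeE:
  assumes "z \<in> generated_lattice u v"
  obtains m n where "z = of_int m * u + of_int n * v"
  using assms by (auto simp: generated_lattice_def)

lemma generated_lattice_add:
  assumes "p \<in> generated_lattice u v" "q \<in> generated_lattice u v"
  shows "p + q \<in> generated_lattice u v"
proof -
  obtain m n m' n' where "p = of_int m * u + of_int n * v" "q = of_int m' * u + of_int n' * v"
    using assms by (metis generated_latticeE)
  then have "p + q = of_int (m + m') * u + of_int (n + n') * v"
    by (simp add: algebra_simps)
  then show ?thesis
    by (metis generated_latticeI)
qed

lemma generated_lattice_uminus:
  assumes "p \<in> generated_lattice u v"
  shows "- p \<in> generated_lattice u v"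
proof -
  obtain m n where "p = of_int m * u + of_int n * v"
    using assms by (metis generated_latticeE)
  then have "- p = of_int (- m) * u + of_int (- n) * v"
    by simp
  then show ?thesis
    by (metis generated_latticeI)
qed

lemma generated_lattice_scale:
  "(*) c ` generated_lattice u v = generated_lattice (c * u) (c * v)"
proof -
  have "c * (of_int m * u + of_int n * v) = of_int m * (c * u) + of_int n * (c * v)" for m n
    by (simp add: algebra_simps)
  then show ?thesis
    unfolding generated_lattice_def image_def by fastforce
qed

text \<open>Multiplication by \<open>c\<close> stretches every distance by the same factor
  \<open>norm c\<close>, so comparisons of distances are unchanged.\<close>

lemma voronoi_cell_scale:
  assumes "c \<noteq> 0"
  shows "voronoi_cell ((*) c ` L) (c * p) = (*) c ` voronoi_cell L p"
proof -
  have iff: "c * w \<in> voronoi_cell ((*) c ` L) (c * p) \<longleftrightarrow> w \<in> voronoi_cell L p" for w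
  proof -
    have "dist (c * w) (c * q) = norm c * dist w q" for q
      by (simp add: dist_norm norm_mult flip: right_diff_distrib)
    then show ?thesis
      using assms by (simp add: voronoi_cell_def)
  qed
  show ?thesis
  proof (intro set_eqI iffI)
    fix z assume "z \<in> voronoi_cell ((*) c ` L) (c * p)"
    moreover have "z = c * (z / c)"
      using assms by simp
    ultimately show "z \<in> (*) c ` voronoi_cell L p"
      using iff by (metis imageI)
  qed (use iff in auto)
qed

text \<open>Translation by a lattice point is an isometry that maps the lattice to itself. This
  reduces every cell to the cell of \<open>0\<close>.\<close>

lemma voronoi_cell_translate:
  assumes "p \<in> generated_lattice u v"
  shows "voronoi_cell (generated_lattice u v) p = (+) p ` voronoi_cell (generated_lattice u v) 0"
    (is "voronoi_cell ?L p = _")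
proof -
  have sub: "(+) p ` voronoi_cell ?L q \<subseteq> voronoi_cell ?L (p + q)"
    if p: "p \<in> ?L" for p q
  proof clarify
    fix w assume w: "w \<in> voronoi_cell ?L q"
    show "p + w \<in> voronoi_cell ?L (p + q)"
      unfolding voronoi_cell_def
    proof clarify
      fix r assume "r \<in> ?L"
      then have "- p + r \<in> ?L"
        using p generated_lattice_add generated_lattice_uminus by blast
      then have "dist w q \<le> dist w (- p + r)"
        using w by (simp add: voronoi_cell_def)
      then show "dist (p + w) (p + q) \<le> dist (p + w) r"
        by (simp add: dist_norm algebra_simps)
    qed
  qed
  \<comment> \<open>The reverse inclusion comes from translating back by \<open>- p\<close>.\<close>
  have "(+) (- p) ` voronoi_cell ?L p \<subseteq> voronoi_cell ?L 0"
    using sub[of "- p" p] generated_lattice_uminus[OF assms] by simp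
  then have "voronoi_cell ?L p \<subseteq> (+) p ` voronoi_cell ?L 0"
    by (force simp: image_iff)
  then show ?thesis
    using sub[OF assms, of 0] by auto
qed

text \<open>Multiplication by \<open>c\<close> is an injective real-linear map of the plane, so it
  commutes with closure and interior.\<close>

lemma frontier_scale_complex:
  fixes c :: complex
  assumes "c \<noteq> 0"
  shows "frontier ((*) c ` S) = (*) c ` frontier S"
proof -
  have "linear ((*) c)"
    by (simp add: linear_times)
  moreover have "inj ((*) c)"
    using assms by (simp add: inj_def)
  ultimately show ?thesis
    by (simp add: frontier_def closure_injective_linear_image interior_injective_linear_image
        image_set_diff)
qed

text \<open>The four neighbours \<open>1\<close>, \<open>-1\<close>, \<open>Complex 0 s\<close>,
  \<open>Complex 0 (- s)\<close> already cut out the rectangle. The other lattice points add no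
  constraint, since the condition splits into one inequality per coordinate.\<close>

lemma voronoi_cell_rectangular:
  fixes s :: real
  assumes "s > 0"
  shows "voronoi_cell (generated_lattice 1 (Complex 0 s)) 0 = {z. \<bar>Re z\<bar> \<le> 1 / 2 \<and> \<bar>Im z\<bar> \<le> s / 2}"
    (is "voronoi_cell ?L 0 = ?R")
proof (intro set_eqI iffI)
  \<comment> \<open>Squaring both distances and cancelling the squared norm of \<open>z\<close>
    leaves a condition linear in \<open>z\<close>.\<close>
  have key: "dist z 0 \<le> dist z (of_int m * 1 + of_int n * Complex 0 s) \<longleftrightarrow>
      2 * (m * Re z + n * (s * Im z)) \<le> (real_of_int m)\<^sup>2 + (real_of_int n)\<^sup>2 * s\<^sup>2" for z m n
    by (simp add: dist_norm cmod_def power2_eq_square algebra_simps)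
  {
    fix z assume z: "z \<in> voronoi_cell ?L 0"
    then have *: "2 * (m * Re z + n * (s * Im z)) \<le> (real_of_int m)\<^sup>2 + (real_of_int n)\<^sup>2 * s\<^sup>2"
      for m n :: int
      using generated_latticeI[of m 1 n "Complex 0 s"] unfolding voronoi_cell_def key[symmetric]
      by blast
    have "\<bar>Re z\<bar> \<le> 1 / 2"
      using *[of 1 0] *[of "-1" 0] by simp
    moreover have "s * (2 * Im z) \<le> s * s" "s * (2 * - Im z) \<le> s * s"
      using *[of 0 1] *[of 0 "-1"] by (simp_all add: power2_eq_square algebra_simps)
    then have "\<bar>Im z\<bar> \<le> s / 2"
      using assms unfolding mult_le_cancel_left_pos[OF assms] by linarith
    ultimately show "z \<in> ?R"
      by simp
  next
    fix z assume z: "z \<in> ?R"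
    have *: "2 * (real_of_int m * t) \<le> (real_of_int m)\<^sup>2" if "\<bar>t\<bar> \<le> 1 / 2" for m :: int and t :: real
    proof -
      have "2 * (m * t) \<le> \<bar>real_of_int m\<bar> * (2 * \<bar>t\<bar>)"
        by (simp add: abs_mult[symmetric])
      also have "\<dots> \<le> \<bar>real_of_int m\<bar>"
        using that by (intro mult_right_le_one_le) auto
      \<comment> \<open>Integrality enters here: the bound fails for reals strictly between 0 and
        1.\<close>
      also have "\<bar>real_of_int m\<bar> \<le> (real_of_int m)\<^sup>2"
      proof -
        have "\<bar>m\<bar> \<le> \<bar>m\<bar> * \<bar>m\<bar>"
          using mult_left_mono[of 1 "\<bar>m\<bar>" "\<bar>m\<bar>"] by (cases "m = 0") auto
        then show ?thesis
          by (simp add: power2_eq_square flip: of_int_abs of_int_mult)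
      qed
      finally show ?thesis .
    qed
    show "z \<in> voronoi_cell ?L 0"
      unfolding voronoi_cell_def
    proof clarify
      fix q assume "q \<in> ?L"
      then obtain m n where q: "q = of_int m * 1 + of_int n * Complex 0 s"
        by (rule generated_latticeE)
      \<comment> \<open>Dividing by \<open>s\<close> normalises the height, so the same
        one-dimensional bound serves both coordinates.\<close>
      have "2 * (real_of_int n * (Im z / s)) \<le> (real_of_int n)\<^sup>2"
        using z assms by (intro *) (simp add: field_simps)
      then have "2 * (real_of_int n * (Im z / s)) * s\<^sup>2 \<le> (real_of_int n)\<^sup>2 * s\<^sup>2"
        by (intro mult_right_mono) auto
      moreover have "2 * (real_of_int n * (Im z / s)) * s\<^sup>2 = 2 * (n * (s * Im z))"
        using assms by (simp add: power2_eq_square)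
      moreover have "2 * (real_of_int m * Re z) \<le> (real_of_int m)\<^sup>2"
        using z by (intro *) simp
      ultimately show "dist z 0 \<le> dist z q"
        unfolding q key by (simp add: algebra_simps)
    qed
  }
qed

lemma frontier_rectangle:
  fixes h k :: real
  shows "frontier {z. \<bar>Re z\<bar> \<le> h \<and> \<bar>Im z\<bar> \<le> k} =
    {z. \<bar>Re z\<bar> \<le> h \<and> \<bar>Im z\<bar> \<le> k \<and> (\<bar>Re z\<bar> = h \<or> \<bar>Im z\<bar> = k)}"
proof -
  have c: "{z. \<bar>Re z\<bar> \<le> h \<and> \<bar>Im z\<bar> \<le> k} = cbox (Complex (- h) (- k)) (Complex h k)"
    by (auto simp: in_cbox_complex_iff)
  have b: "box (Complex (- h) (- k)) (Complex h k) = {z. \<bar>Re z\<bar> < h \<and> \<bar>Im z\<bar> < k}"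
    by (auto simp: in_box_complex_iff abs_less_iff)
  show ?thesis
    unfolding c frontier_cbox b unfolding c[symmetric] by auto
qed

text \<open>The principal square root of a nonpositive real lies on the nonnegative imaginary axis,
  which fixes the sign.\<close>

lemma csqrt_neg_of_nat: "csqrt (- of_nat N) = Complex 0 (sqrt (real N))"
proof -
  have "csqrt (of_real (- real N)) = \<i> * sqrt (real N)"
    by (subst csqrt_of_real_nonpos) auto
  then show ?thesis
    by (simp add: complex_eq_iff)
qed

lemma odd_norm_iff: "odd (a\<^sup>2 + int N * b\<^sup>2) \<longleftrightarrow> odd (a + int N * b)"
  by auto

theorem theorem7:
  fixes N :: nat and a b :: int and \<theta> \<alpha> :: complex and L :: "complex set"
  assumes "N \<ge> 1"
    and "\<theta> = csqrt (- of_nat N)"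
    and "L = generated_lattice 1 \<theta>"
    and "\<alpha> = of_int a + of_int b * \<theta>"
    and "\<alpha> \<noteq> 0"
  shows "(voronoi_cell L 0 = {z. \<bar>Re z\<bar> \<le> 1 / 2 \<and> \<bar>Im z\<bar> \<le> sqrt (real N) / 2}) \<and>
         (sublattice ((*) \<alpha> ` L) L) \<and>
         (\<alpha> * cnj \<alpha> = of_int (a\<^sup>2 + int N * b\<^sup>2)) \<and>
         (clean_sublattice ((*) \<alpha> ` L) L \<longleftrightarrow> odd (a\<^sup>2 + int N * b\<^sup>2)) \<and>
         (odd (a\<^sup>2 + int N * b\<^sup>2) \<longleftrightarrow> odd (a + int N * b))"
proof -
  define s where "s = sqrt (real N)"
  have s: "s > 0" and ss: "s * s = real N"
    using assms(1) by (auto simp: s_def)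
  have \<theta>: "\<theta> = Complex 0 s"
    unfolding assms(2) s_def by (rule csqrt_neg_of_nat)
  have \<theta>\<theta>: "\<theta> * \<theta> = - of_nat N"
    by (simp add: \<theta> complex_eq_iff ss)
  have LI: "of_int m + of_int n * \<theta> \<in> L" for m n
    using generated_latticeI[of m 1 n \<theta>] assms(3) by simp
  have LE: "\<exists>m n. z = of_int m + of_int n * \<theta>" if "z \<in> L" for z
    using that generated_latticeE[of z 1 \<theta>] assms(3) by (metis mult.right_neutral)
  define R where "R = {z. \<bar>Re z\<bar> \<le> 1 / 2 \<and> \<bar>Im z\<bar> \<le> s / 2}"
  have cell: "voronoi_cell L 0 = R"
    unfolding assms(3) \<theta> R_def using s by (rule voronoi_cell_rectangular)
  define n where "n = a\<^sup>2 + int N * b\<^sup>2"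
  have norm: "\<alpha> * cnj \<alpha> = of_int n"
    by (simp add: assms(4) \<theta> n_def complex_eq_iff power2_eq_square algebra_simps flip: ss)

  have sub: "sublattice ((*) \<alpha> ` L) L"
    unfolding sublattice_def
  proof (intro conjI subsetI)
    show "is_lattice L"
      unfolding assms(3) by (rule is_lattice_generated) (use s in \<open>simp add: \<theta>\<close>)
    \<comment> \<open>The determinant of the scaled basis is the norm of \<alpha> times
      \<open>s\<close>.\<close>
    have "cnj (\<alpha> * 1) * (\<alpha> * \<theta>) = (\<alpha> * cnj \<alpha>) * \<theta>"
      by simp
    also have "Im \<dots> = n * s"
      unfolding norm by (simp add: \<theta>)
    also have "\<dots> \<noteq> 0"
      using assms(5) norm s by auto
    finally have "Im (cnj (\<alpha> * 1) * (\<alpha> * \<theta>)) \<noteq> 0" .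
    then show "is_lattice ((*) \<alpha> ` L)"
      unfolding assms(3) generated_lattice_scale by (rule is_lattice_generated)
  next
    fix z assume "z \<in> (*) \<alpha> ` L"
    then obtain k l where "z = \<alpha> * (of_int k + of_int l * \<theta>)"
      using LE by blast
    also have "\<dots> = of_int (a * k) + of_int (a * l + b * k) * \<theta> + of_int (b * l) * (\<theta> * \<theta>)"
      by (simp add: assms(4) algebra_simps)
    also have "\<dots> = of_int (a * k - int N * b * l) + of_int (a * l + b * k) * \<theta>"
      by (simp add: \<theta>\<theta>)
    finally show "z \<in> L"
      by (simp only: LI)
  qed

  have frontier_R: "frontier R = {z. \<bar>Re z\<bar> \<le> 1 / 2 \<and> \<bar>Im z\<bar> \<le> s / 2 \<and> (\<bar>Re z\<bar> = 1 / 2 \<or> \<bar>Im z\<bar> = s / 2)}"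
    unfolding R_def by (rule frontier_rectangle)
  have frontier_cell: "frontier (voronoi_cell ((*) \<alpha> ` L) (\<alpha> * p)) = (\<lambda>x. \<alpha> * (p + x)) ` frontier R"
    if "p \<in> L" for p
  proof -
    have "voronoi_cell L p = (+) p ` R"
      using that cell voronoi_cell_translate unfolding assms(3) by blast
    then have "voronoi_cell ((*) \<alpha> ` L) (\<alpha> * p) = (*) \<alpha> ` (+) p ` R"
      using voronoi_cell_scale[OF assms(5)] by simp
    then show ?thesis
      by (simp only: frontier_scale_complex[OF assms(5)] frontier_translation) (simp only: image_image)
  qed

  have "clean_sublattice ((*) \<alpha> ` L) L \<longleftrightarrow> odd n"
  proof
    assume "odd n"
    have False if pL: "p \<in> L" and x: "x \<in> frontier R" and \<lambda>: "\<alpha> * (p + x) \<in> L" for p x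
    proof -
      obtain k l where p: "p = of_int k + of_int l * \<theta>"
        using LE[OF pL] by blast
      obtain c d where cd: "\<alpha> * (p + x) = of_int c + of_int d * \<theta>"
        using LE[OF \<lambda>] by blast
      \<comment> \<open>Multiplying by \<open>cnj \<alpha>\<close> turns the factor \<alpha> into
        the integer \<open>n\<close>, so the two coordinates can be compared separately.\<close>
      have "of_int n * (p + x) = cnj \<alpha> * (\<alpha> * (p + x))"
        by (simp flip: norm)
      then have eq: "of_int n * (p + x) = cnj \<alpha> * (of_int c + of_int d * \<theta>)"
        by (simp add: cd)
      have re: "n * (k + Re x) = real_of_int (a * c + int N * b * d)"
        using arg_cong[OF eq, of Re] by (simp add: p \<theta> assms(4) algebra_simps flip: ss)
      have "s * (n * (l + Im x / s)) = s * real_of_int (a * d - b * c)"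
        using arg_cong[OF eq, of Im] s by (simp add: p \<theta> assms(4) algebra_simps)
      then have im: "n * (l + Im x / s) = real_of_int (a * d - b * c)"
        using s by simp
      \<comment> \<open>Here \<open>t\<close> is half an odd integer \<open>e\<close>, so clearing
        denominators equates a product of two odd integers with an even one.\<close>
      have half: False if "real_of_int n * (of_int j + t) = of_int u" "\<bar>t\<bar> = 1 / 2" for j u t
      proof -
        obtain e where e: "odd e" "t = of_int e / 2"
        proof
          show "odd (if t \<ge> 0 then 1 else - 1 :: int)" "t = of_int (if t \<ge> 0 then 1 else - 1) / 2"
            using \<open>\<bar>t\<bar> = 1 / 2\<close> by (auto split: if_splits)
        qed
        have "real_of_int (n * (2 * j + e)) = of_int (2 * u)"
          using that(1) e(2) by (simp add: algebra_simps)
        then have "n * (2 * j + e) = 2 * u"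
          unfolding of_int_eq_iff .
        then show False
          using \<open>odd n\<close> e(1) by (metis dvd_triv_left even_add even_mult_iff)
      qed
      have "\<bar>Re x\<bar> = 1 / 2 \<or> \<bar>Im x / s\<bar> = 1 / 2"
        using x s by (auto simp: frontier_R abs_divide)
      then show False
        using half[OF re] half[OF im] by blast
    qed
    then show "clean_sublattice ((*) \<alpha> ` L) L"
      using sub frontier_cell by (fastforce simp: clean_sublattice_def)
  next
    assume clean: "clean_sublattice ((*) \<alpha> ` L) L"
    have notin: "\<alpha> * x \<notin> L" if "x \<in> frontier R" for x
    proof -
      have "0 \<in> L"
        using LI[of 0 0] by simp
      then have "frontier (voronoi_cell ((*) \<alpha> ` L) (\<alpha> * 0)) \<inter> L = {}"
        using clean unfolding clean_sublattice_def by blast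
      then show ?thesis
        using frontier_cell[OF \<open>0 \<in> L\<close>] that by auto
    qed
    \<comment> \<open>Two side midpoints and a corner of the rectangle, one witness for each parity
      case below.\<close>
    have R: "1 / 2 \<in> frontier R" "\<theta> / 2 \<in> frontier R" "(1 + \<theta>) / 2 \<in> frontier R"
      using s by (auto simp: frontier_R \<theta>)
    show "odd n"
    proof
      assume "even n"
      then have ev: "even (a + int N * b)"
        using odd_norm_iff unfolding n_def by blast
      \<comment> \<open>If \<open>a\<close> is even, then \<open>int N * b\<close> is even, so
        \<open>b\<close> or \<open>N\<close> is; if \<open>a\<close> is odd, both must be
        odd.\<close>
      consider "even a" "even b" | "even a" "even N" | "odd a" "odd b" "odd N"
        using ev by auto
      then show False
      proof cases
        case 1
        then obtain c d where "a = 2 * c" "b = 2 * d"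
          by (auto elim!: evenE)
        then have "\<alpha> * (1 / 2) = of_int c + of_int d * \<theta>"
          by (simp add: assms(4) field_simps)
        then show False
          using notin[OF R(1)] LI by metis
      next
        case 2
        then obtain c M where cM: "a = 2 * c" "N = 2 * M"
          by (auto elim!: evenE)
        have "\<alpha> * (\<theta> / 2) = (of_int a * \<theta> + of_int b * (\<theta> * \<theta>)) / 2"
          by (simp add: assms(4) algebra_simps)
        also have "\<dots> = of_int (- b * int M) + of_int c * \<theta>"
          unfolding \<theta>\<theta> by (simp add: cM)
        finally show False
          using notin[OF R(2)] LI by metis
      next
        case 3
        then have "even (a - int N * b)" "even (a + b)"
          by auto
        then obtain c d where c: "a - int N * b = 2 * c" and d: "a + b = 2 * d"
          unfolding dvd_def by blast
        have "\<alpha> * ((1 + \<theta>) / 2) = (of_int a + of_int b * (\<theta> * \<theta>) + of_int (a + b) * \<theta>) / 2"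
          by (simp add: assms(4) field_simps)
        also have "\<dots> = (of_int (a - int N * b) + of_int (a + b) * \<theta>) / 2"
          unfolding \<theta>\<theta> by simp
        also have "\<dots> = of_int c + of_int d * \<theta>"
          unfolding c d by (simp add: field_simps)
        finally show False
          using notin[OF R(3)] LI by metis
      qed
    qed
  qed
  then show ?thesis
    using cell sub norm odd_norm_iff[of a N b] unfolding R_def s_def n_def by blast
qed

end
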